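(* For any connected graph $G$ on $n$ vertices, $$ \log_2 n \le \mathrm{pq}(G) \le \mathrm{eq}(G) \le n-1. $$ In fact, there exists a strategy of the algorithm, using edge queries, that in each round (as long as at least two potential targets remain) eliminates at least one vertex from the search space, that is, $|V_t|\le |V_{t-1}|-1$ whenever $|V_{t-1}|\ge 2$, regardless of the replies of the adversary.
   Context: Query game on a simple graph $G=(V,E)$: $d_G(u,v)$ denotes the graph distance. An adversary fixes a target vertex $v^*\in V$ unknown to an adaptive algorithm. In each round the algorithm queries two vertices $u,v$, and the adversary replies with whichever of $u,v$ is closer to $v^*$ (with either one, at the adversary's choice, if $d_G(u,v^* )=d_G(v,v^* )$). Equivalently: put $V_0=V$; in round $t$ the algorithm presents $(u_t,v_t)$ (depending on $G$ and earlier replies) and the adversary chooses either $V_t=\{x\in V_{t-1}: d_G(u_t,x)\le d_G(v_t,x)\}$ (reply $u_t$) or $V_t=\{x\in V_{t-1}: d_G(v_t,x)\le d_G(u_t,x)\}$ (reply $v_t$); $V_t$ is the search space (set of potential targets) after $t$ rounds, and the target is located once $|V_t|=1$. A pair query allows arbitrary $u,v\in V$; an edge query requires $u$ and $v$ to be adjacent. $\mathrm{pq}(G)$ (respectively $\mathrm{eq}(G)$) is the least integer $t$ such that the algorithm can locate the target in at most $t$ pair queries (respectively edge queries), regardless of the strategy of the adversary. *)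

theory Defs
  imports "Graph_Theory.Graph_Theory" "HOL-Library.Extended_Nat" Complex_Main
begin

definition graph_dist :: "('a, 'b) pre_digraph \<Rightarrow> 'a \<Rightarrow> 'a \<Rightarrow> ereal" where
  "graph_dist G u v = wf_digraph.\<mu> G (\<lambda>_. 1) u v"

datatype reply = First | Second

(* A deterministic adaptive algorithm: it maps the replies received so far, most recent
   one first, to the next query. Earlier queries are determined by earlier replies. *)
type_synonym 'a strategy = "reply list \<Rightarrow> 'a \<times> 'a"

fun compatible_targets :: "('a, 'b) pre_digraph \<Rightarrow> 'a \<times> 'a \<Rightarrow> reply \<Rightarrow> 'a set" where
  "compatible_targets G (u, v) First = {x \<in> verts G. graph_dist G u x \<le> graph_dist G v x}"
| "compatible_targets G (u, v) Second = {x \<in> verts G. graph_dist G v x \<le> graph_dist G u x}"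

primrec search_space :: "('a, 'b) pre_digraph \<Rightarrow> 'a strategy \<Rightarrow> reply list \<Rightarrow> 'a set" where
  "search_space G \<sigma> [] = verts G"
| "search_space G \<sigma> (r # h) = search_space G \<sigma> h \<inter> compatible_targets G (\<sigma> h) r"

(* Queries have to be legal only while the target is not located: the graph with a single
   vertex admits no edge query at all. *)
definition pair_strategy :: "('a, 'b) pre_digraph \<Rightarrow> 'a strategy \<Rightarrow> bool" where
  "pair_strategy G \<sigma> \<longleftrightarrow>
     (\<forall>h. 2 \<le> card (search_space G \<sigma> h) \<longrightarrow> fst (\<sigma> h) \<in> verts G \<and> snd (\<sigma> h) \<in> verts G)"

definition edge_strategy :: "('a, 'b) pre_digraph \<Rightarrow> 'a strategy \<Rightarrow> bool" where
  "edge_strategy G \<sigma> \<longleftrightarrow>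
     (\<forall>h. 2 \<le> card (search_space G \<sigma> h) \<longrightarrow> fst (\<sigma> h) \<rightarrow>\<^bsub>G\<^esub> snd (\<sigma> h))"

(* The replies h can be given for some fixed target iff search_space G \<sigma> h is nonempty: its
   elements are exactly the targets for which all replies are truthful. The search space after
   the first length h - k replies is search_space G \<sigma> (drop k h). *)
definition locates_within :: "('a, 'b) pre_digraph \<Rightarrow> 'a strategy \<Rightarrow> nat \<Rightarrow> bool" where
  "locates_within G \<sigma> t \<longleftrightarrow>
     (\<forall>h. length h = t \<and> search_space G \<sigma> h \<noteq> {} \<longrightarrow>
        (\<exists>k\<le>t. card (search_space G \<sigma> (drop k h)) = 1))"

(* The least number of rounds as an extended natural, \<infinity> if no number of rounds suffices. *)
definition pair_query_number :: "('a, 'b) pre_digraph \<Rightarrow> enat" where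
  "pair_query_number G = Inf {enat t | t. \<exists>\<sigma>. pair_strategy G \<sigma> \<and> locates_within G \<sigma> t}"

definition edge_query_number :: "('a, 'b) pre_digraph \<Rightarrow> enat" where
  "edge_query_number G = Inf {enat t | t. \<exists>\<sigma>. edge_strategy G \<sigma> \<and> locates_within G \<sigma> t}"

end

theory Submission
  imports Defs
begin

text \<open>
  The edge query for a search space containing \<open>x \<noteq> y\<close> is \<open>(x, v)\<close>, where \<open>v\<close> is the second
  vertex of a shortest path from \<open>x\<close> to \<open>y\<close>: the reply \<open>x\<close> excludes \<open>y\<close>, since \<open>v\<close> is closer to
  \<open>y\<close>, and the reply \<open>v\<close> excludes \<open>x\<close>. For the lower bound, each target gives at least one
  truthful list of \<open>t\<close> replies, and a successful algorithm needs distinct lists for distinct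
  targets.
\<close>

lemma (in wf_digraph) graph_dist_self_le: "x \<in> verts G \<Longrightarrow> graph_dist G x x \<le> 0"
  using min_cost_le_walk_cost[of x "[]" x "\<lambda>_. 1"] by (simp add: graph_dist_def awalk_Nil_iff zero_ereal_def)

text \<open>A walk between distinct vertices has a first arc, of cost 1, and its other arcs have
  nonnegative cost. If there is no walk at all, the infimum is \<infinity>.\<close>

lemma (in wf_digraph) graph_dist_ge_1:
  assumes "u \<noteq> v"
  shows "1 \<le> graph_dist G u v"
  unfolding graph_dist_def \<mu>_def
proof (rule INF_greatest)
  fix p assume "p \<in> {p. awalk u p v}"
  with assms obtain e q where "p = e # q"
    by (cases p) (auto simp: awalk_Nil_iff)
  moreover have "0 \<le> awalk_cost (\<lambda>_. 1) q"
    by (induction q) auto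
  ultimately show "1 \<le> ereal (awalk_cost (\<lambda>_. 1) p)"
    by (simp add: one_ereal_def)
qed

lemma (in fin_digraph) ex_neighbour_closer:
  assumes "x \<rightarrow>\<^sup>* y" and "x \<noteq> y"
  shows "\<exists>v. x \<rightarrow> v \<and> graph_dist G v y < graph_dist G x y"
proof -
  obtain p where p: "apath x p y" "graph_dist G x y = awalk_cost (\<lambda>_. 1) p"
    using min_cost_awalk[OF assms(1), of "\<lambda>_. 1"] by (auto simp: graph_dist_def)
  with assms(2) obtain e q where "p = e # q"
    by (cases p) (auto simp: apath_def awalk_Nil_iff)
  with p(1) have e: "e \<in> arcs G" "tail G e = x" and q: "awalk (head G e) q y"
    by (auto simp: apath_def awalk_Cons_iff)
  have "graph_dist G (head G e) y \<le> awalk_cost (\<lambda>_. 1) q"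
    unfolding graph_dist_def by (rule min_cost_le_walk_cost[OF q])
  \<comment> \<open>The minimum is attained by the walk \<open>p\<close>, so the distance is a real
    number and dropping one arc of cost 1 lowers it strictly.\<close>
  also have "\<dots> < graph_dist G x y"
    by (simp add: p(2) \<open>p = e # q\<close>)
  finally have "graph_dist G (head G e) y < graph_dist G x y" .
  moreover have "x \<rightarrow> head G e"
    using e in_arcs_imp_in_arcs_ends by fastforce
  ultimately show ?thesis
    by blast
qed

text \<open>Depends on the history only through the set \<open>S\<close>, so that a query can be
  chosen from the current search space alone.\<close>

definition shrinking_edge :: "('a, 'b) pre_digraph \<Rightarrow> 'a set \<Rightarrow> 'a \<times> 'a \<Rightarrow> bool" where
  "shrinking_edge G S e \<longleftrightarrow>
     fst e \<rightarrow>\<^bsub>G\<^esub> snd e \<and> (\<forall>r. S \<inter> compatible_targets G e r \<subset> S)"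

lemma (in fin_digraph) ex_shrinking_edge:
  assumes "strongly_connected G" and "S \<subseteq> verts G" and "2 \<le> card S"
  shows "\<exists>e. shrinking_edge G S e"
proof -
  obtain x y where xy: "x \<in> S" "y \<in> S" "x \<noteq> y"
    using assms(3) by (metis One_nat_def Suc_1 card_le_Suc0_iff_eq card.infinite not_less_eq_eq zero_le)
  then have "x \<rightarrow>\<^sup>* y"
    using assms(1,2) by (auto simp: strongly_connected_def)
  then obtain v where v: "x \<rightarrow> v" "graph_dist G v y < graph_dist G x y"
    using ex_neighbour_closer xy(3) by blast
  have "graph_dist G x x \<le> 0"
    using graph_dist_self_le xy(1) assms(2) by blast
  also have "(0::ereal) < 1"
    by simp
  also have "1 \<le> graph_dist G v x"
    \<comment> \<open>\<open>v\<close> differs from \<open>x\<close> because it is strictly closer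
      to \<open>y\<close>.\<close>
    by (rule graph_dist_ge_1) (use v(2) in auto)
  finally have "graph_dist G x x < graph_dist G v x" .
  have "S \<inter> compatible_targets G (x, v) r \<subset> S" for r
  proof (cases r)
    case First
    with v(2) have "y \<notin> compatible_targets G (x, v) r"
      by (simp add: not_le)
    with xy(2) show ?thesis
      by blast
  next
    case Second
    with \<open>graph_dist G x x < graph_dist G v x\<close> have "x \<notin> compatible_targets G (x, v) r"
      by (simp add: not_le)
    with xy(1) show ?thesis
      by blast
  qed
  with v(1) show ?thesis
    unfolding shrinking_edge_def by (intro exI[of _ "(x, v)"]) simp
qed

text \<open>Choosing queries from the search space is circular: \<open>search_space\<close> takes
  the strategy as an argument. Here the recursion runs on a rule \<open>q\<close> from sets to
  queries instead, and the strategy is read off afterwards.\<close>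

primrec remaining_targets ::
    "('a, 'b) pre_digraph \<Rightarrow> ('a set \<Rightarrow> 'a \<times> 'a) \<Rightarrow> reply list \<Rightarrow> 'a set" where
  "remaining_targets G q [] = verts G"
| "remaining_targets G q (r # h) =
     remaining_targets G q h \<inter> compatible_targets G (q (remaining_targets G q h)) r"

lemma search_space_remaining_targets:
  "search_space G (\<lambda>h. q (remaining_targets G q h)) h = remaining_targets G q h"
  by (induction h) auto

lemma search_space_subset_verts: "search_space G \<sigma> h \<subseteq> verts G"
  by (induction h) auto

text \<open>Replies are listed most recent first, so \<open>drop k h\<close> is the history
  \<open>k\<close> rounds earlier.\<close>

lemma search_space_subset_drop: "search_space G \<sigma> h \<subseteq> search_space G \<sigma> (drop k h)"
proof (induction h arbitrary: k)
  case (Cons r h)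
  then show ?case
    by (cases k) auto
qed simp

lemma (in fin_digraph) finite_search_space: "finite (search_space G \<sigma> h)"
  using search_space_subset_verts finite_verts by (rule finite_subset)

lemma (in fin_digraph) ex_decreasing_edge_strategy:
  assumes "strongly_connected G"
  shows "\<exists>\<sigma>. edge_strategy G \<sigma> \<and>
           (\<forall>h r. 2 \<le> card (search_space G \<sigma> h) \<longrightarrow>
              card (search_space G \<sigma> (r # h)) \<le> card (search_space G \<sigma> h) - 1)"
proof -
  \<comment> \<open>For sets without a shrinking edge the chosen value is arbitrary. This is
    harmless, as queries need to be legal only while two targets remain.\<close>
  define q where "q S = (SOME e. shrinking_edge G S e)" for S
  define \<sigma> where "\<sigma> = (\<lambda>h. q (remaining_targets G q h))"
  have \<sigma>: "\<sigma> h = q (search_space G \<sigma> h)" for h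
    unfolding \<sigma>_def search_space_remaining_targets ..
  have shrinking: "shrinking_edge G (search_space G \<sigma> h) (\<sigma> h)" if "2 \<le> card (search_space G \<sigma> h)" for h
    unfolding \<sigma>[of h] q_def
    using ex_shrinking_edge[OF assms search_space_subset_verts that] by (rule someI_ex)
  have "edge_strategy G \<sigma>"
    using shrinking by (simp add: edge_strategy_def shrinking_edge_def)
  moreover have "card (search_space G \<sigma> (r # h)) \<le> card (search_space G \<sigma> h) - 1"
    if "2 \<le> card (search_space G \<sigma> h)" for h r
  proof -
    have "search_space G \<sigma> (r # h) \<subset> search_space G \<sigma> h"
      using shrinking[OF that] by (simp add: shrinking_edge_def)
    then have "card (search_space G \<sigma> (r # h)) < card (search_space G \<sigma> h)"
      using finite_search_space psubset_card_mono by blast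
    then show ?thesis
      by simp
  qed
  ultimately show ?thesis
    by blast
qed

lemma (in fin_digraph) locates_within_if_decreasing:
  assumes decr: "\<And>h r. 2 \<le> card (search_space G \<sigma> h) \<Longrightarrow>
      card (search_space G \<sigma> (r # h)) \<le> card (search_space G \<sigma> h) - 1"
  shows "locates_within G \<sigma> (card (verts G) - 1)"
proof -
  \<comment> \<open>Until a singleton has occurred, every reply costs at least one vertex, so the
    size of the search space plus the number of rounds never exceeds the initial size.\<close>
  have bound: "(\<exists>k\<le>length h. card (search_space G \<sigma> (drop k h)) = 1)
      \<or> card (search_space G \<sigma> h) + length h \<le> card (verts G)"
    if "search_space G \<sigma> h \<noteq> {}" for h
    using that
  proof (induction h)
    case (Cons r h)
    then have ne: "search_space G \<sigma> h \<noteq> {}"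
      by auto
    show ?case
    proof (cases "\<exists>k\<le>length h. card (search_space G \<sigma> (drop k h)) = 1")
      case True
      then obtain k where "k \<le> length h" "card (search_space G \<sigma> (drop k h)) = 1"
        by blast
      then show ?thesis
        \<comment> \<open>The new reply stands at the head of the list, so the earlier singleton is
          now one round further back.\<close>
        by (intro disjI1 exI[of _ "Suc k"]) simp
    next
      case False
      then have "card (search_space G \<sigma> h) \<noteq> 1"
        by (metis drop0 zero_le)
      moreover have "card (search_space G \<sigma> h) \<noteq> 0"
        using ne finite_search_space by simp
      ultimately have "2 \<le> card (search_space G \<sigma> h)"
        by linarith
      from decr[OF this, of r] this Cons.IH[OF ne] False show ?thesis
        by (auto simp del: search_space.simps)
    qed
  qed simp
  show ?thesis
    unfolding locates_within_def
  proof (intro allI impI)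
    fix h assume h: "length h = card (verts G) - 1 \<and> search_space G \<sigma> h \<noteq> {}"
    then have "0 < card (search_space G \<sigma> h)"
      using finite_search_space by (simp add: card_gt_0_iff)
    \<comment> \<open>After \<open>card (verts G) - 1\<close> replies the second alternative leaves
      at most one target; the search space is nonempty, so it is a singleton now, which is the case
      \<open>k = 0\<close>.\<close>
    with h bound[of h] have "(\<exists>k\<le>length h. card (search_space G \<sigma> (drop k h)) = 1)
        \<or> card (search_space G \<sigma> (drop 0 h)) = 1"
      by auto
    with h show "\<exists>k\<le>card (verts G) - 1. card (search_space G \<sigma> (drop k h)) = 1"
      by (metis zero_le)
  qed
qed

text \<open>Distances are linearly ordered, so each query has a reply that keeps \<open>x\<close>;
  on a tie both do.\<close>

lemma ex_truthful_replies:
  assumes "x \<in> verts G"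
  shows "\<exists>h. length h = t \<and> x \<in> search_space G \<sigma> h"
proof (induction t)
  case 0
  with assms show ?case
    by simp
next
  case (Suc t)
  then obtain h where h: "length h = t" "x \<in> search_space G \<sigma> h"
    by blast
  obtain u v where uv: "\<sigma> h = (u, v)"
    by fastforce
  have "\<exists>r. x \<in> compatible_targets G (\<sigma> h) r"
    unfolding uv using assms linear[of "graph_dist G u x" "graph_dist G v x"]
    by (metis (mono_tags, lifting) compatible_targets.simps mem_Collect_eq)
  then obtain r where "x \<in> compatible_targets G (\<sigma> h) r" ..
  with h show ?case
    by (intro exI[of _ "r # h"]) simp
qed

lemma UNIV_reply: "UNIV = {First, Second}"
  using reply.exhaust by auto

lemma card_verts_le_if_locates_within:
  assumes "locates_within G \<sigma> t"
  shows "card (verts G) \<le> 2 ^ t"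
proof -
  have "\<forall>x\<in>verts G. \<exists>h. length h = t \<and> x \<in> search_space G \<sigma> h"
    by (intro ballI ex_truthful_replies)
  then obtain f where f: "\<And>x. x \<in> verts G \<Longrightarrow> length (f x) = t \<and> x \<in> search_space G \<sigma> (f x)"
    by metis
  \<comment> \<open>Targets with the same replies lie together in the final search space, hence in
    every earlier one, and one of these is a singleton.\<close>
  have "inj_on f (verts G)"
  proof (rule inj_onI)
    fix x y assume xy: "x \<in> verts G" "y \<in> verts G" "f x = f y"
    with f have "x \<in> search_space G \<sigma> (f x)" "y \<in> search_space G \<sigma> (f x)"
      by metis+
    moreover from this obtain k where "card (search_space G \<sigma> (drop k (f x))) = 1"
      using assms f[OF xy(1)] unfolding locates_within_def by blast
    ultimately show "x = y"
      using search_space_subset_drop[of G \<sigma> "f x" k]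
      by (metis One_nat_def card_1_singletonE singletonD subsetD)
  qed
  moreover have "f ` verts G \<subseteq> {h. set h \<subseteq> UNIV \<and> length h = t}"
    using f by auto
  moreover have "finite {h :: reply list. set h \<subseteq> UNIV \<and> length h = t}"
    by (rule finite_lists_length_eq) (simp add: UNIV_reply)
  ultimately have "card (verts G) \<le> card {h :: reply list. set h \<subseteq> UNIV \<and> length h = t}"
    by (rule card_inj_on_le)
  also have "\<dots> = card (UNIV :: reply set) ^ t"
    by (rule card_lists_length_eq) (simp add: UNIV_reply)
  also have "\<dots> = 2 ^ t"
    by (simp add: UNIV_reply numeral_2_eq_2)
  finally show ?thesis .
qed

text \<open>A nonempty set of extended naturals attains its infimum, so the counting bound applies
  to a single strategy with that number of rounds; the empty set has infimum \<infinity>.\<close>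

lemma log_card_verts_le_pair_query_number:
  assumes "0 < card (verts G)"
  shows "ereal (log 2 (real (card (verts G)))) \<le> ereal_of_enat (pair_query_number G)"
proof (cases "{enat t | t. \<exists>\<sigma>. pair_strategy G \<sigma> \<and> locates_within G \<sigma> t} = {}")
  case True
  then have "pair_query_number G = \<infinity>"
    unfolding pair_query_number_def by (simp only: Inf_enat_def refl if_True)
  then show ?thesis
    by simp
next
  case False
  then have "pair_query_number G \<in> {enat t | t. \<exists>\<sigma>. pair_strategy G \<sigma> \<and> locates_within G \<sigma> t}"
    unfolding pair_query_number_def by (rule wellorder_InfI[OF some_in_eq[THEN iffD2]])
  then obtain t \<sigma> where t: "pair_query_number G = enat t" "locates_within G \<sigma> t"
    by auto
  then have "real (card (verts G)) \<le> 2 ^ t"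
    using card_verts_le_if_locates_within by (metis of_nat_le_iff of_nat_numeral of_nat_power)
  then have "log 2 (real (card (verts G))) \<le> t"
    using assms by (simp add: log_le_iff powr_realpow)
  with t(1) show ?thesis
    by simp
qed

lemma (in wf_digraph) pair_query_number_le_edge_query_number:
  "pair_query_number G \<le> edge_query_number G"
  unfolding pair_query_number_def edge_query_number_def
proof (rule Inf_superset_mono)
  have "pair_strategy G \<sigma>" if "edge_strategy G \<sigma>" for \<sigma>
    using that adj_in_verts unfolding pair_strategy_def edge_strategy_def by blast
  then show "{enat t | t. \<exists>\<sigma>. edge_strategy G \<sigma> \<and> locates_within G \<sigma> t}
      \<subseteq> {enat t | t. \<exists>\<sigma>. pair_strategy G \<sigma> \<and> locates_within G \<sigma> t}"
    by blast
qed

theorem mainTheorem8: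
  fixes G :: "('a, 'b) pre_digraph" and n :: nat
  assumes "Digraph.graph G" and "Digraph_Component.connected G" and "card (verts G) = n"
  shows "ereal (log 2 (real n)) \<le> ereal_of_enat (pair_query_number G)
       \<and> pair_query_number G \<le> edge_query_number G
       \<and> edge_query_number G \<le> enat (n - 1)
       \<and> (\<exists>\<sigma>. edge_strategy G \<sigma> \<and>
            (\<forall>h r. 2 \<le> card (search_space G \<sigma> h) \<longrightarrow>
               card (search_space G \<sigma> (r # h)) \<le> card (search_space G \<sigma> h) - 1))"
proof -
  interpret graph G
    by (fact assms(1))
  \<comment> \<open>Arcs come in both directions, so connectedness gives directed paths between all
    vertices. Strong connectedness also includes that there is a vertex, which makes
    \<open>n\<close> positive for the logarithm.\<close>
  have sc: "strongly_connected G"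
    using symmetric_connected_imp_strongly_connected sym_arcs assms(2) by blast
  then have "0 < card (verts G)"
    using finite_verts by (auto simp: strongly_connected_def card_gt_0_iff)
  then have lower: "ereal (log 2 (real n)) \<le> ereal_of_enat (pair_query_number G)"
    using log_card_verts_le_pair_query_number assms(3) by blast
  obtain \<sigma> where \<sigma>: "edge_strategy G \<sigma>"
      "\<forall>h r. 2 \<le> card (search_space G \<sigma> h) \<longrightarrow>
         card (search_space G \<sigma> (r # h)) \<le> card (search_space G \<sigma> h) - 1"
    using ex_decreasing_edge_strategy[OF sc] by blast
  then have "locates_within G \<sigma> (n - 1)"
    using locates_within_if_decreasing assms(3) by blast
  with \<sigma>(1) have "edge_query_number G \<le> enat (n - 1)"
    unfolding edge_query_number_def by (intro Inf_lower) blast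
  with lower \<sigma> pair_query_number_le_edge_query_number show ?thesis
    by blast
qed

end
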